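(* Let $S$ be a compact, connected, boundaryless smooth Riemannian surface with an area form, and let $f\colon S\to S$ be a differentiable map. Then for all $x\in S$ and all $v\in T_xS$ the new Lyapunov exponent of $f$ at $x$ in the direction $v$ coincides with the usual Lyapunov exponent: $$\chi^+_N(f,x,v)=\chi^+(f,x,v).$$
   Context: Charts and norms. Let $\lambda$ be the measure on $S$ induced by the area form (the Lebesgue measure on $S$). Fix a finite smooth atlas $\{\varphi_i\colon U_i\to\mathbb{R}^2\}_{i=1}^k$ of $S$ with $U_i$ open, whose charts are conservative (they carry $\lambda$ to the Lebesgue measure of $\mathbb{R}^2$). For $x\in S$ put $i(x):=\min\{i : x\in U_i\}$. For $v\in T_xS$ put $\|v\|:=\|D\varphi_{i(x)}\cdot v\|$ (Euclidean norm). The vector $D\varphi_{i(x)}\cdot v\in\mathbb{R}^2$ is still denoted $v$. $d$ denotes the distance on $S$. Dynamical balls. For continuous $f\colon S\to S$, $x\in S$, $\delta>0$, $n\in\mathbb{N}$, $$B_x(\delta,n):=\{y\in S : d(f^j(x),f^j(y))<\delta \text{ for } j=0,1,\dots,n\}.$$ Difference quotients. $\Delta(f,n,x,y):=\dfrac{\|f^n(x)-f^n(y)\|}{\|x-y\|}$, where differences are computed in the charts: $x-y$ means $\varphi_{i(x)}(x)-\varphi_{i(x)}(y)$ and $f^n(x)-f^n(y)$ means $\varphi_{i(f^n(x))}(f^n(x))-\varphi_{i(f^n(x))}(f^n(y))$; for fixed $x$ and $n$ this makes sense for all $y\in B_x(\delta,n)\setminus\{x\}$ once $\delta$ is small enough.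 For $v\in T_xS$, $L_{x,v}:=\{x+kv : k\in\mathbb{R}\}\subset\mathbb{R}^2$ (in the chart $\varphi_{i(x)}$), and $y\in L_{x,v}$ means $\varphi_{i(x)}(y)\in\{\varphi_{i(x)}(x)+k\,D\varphi_{i(x)}\cdot v: k\in\mathbb{R}\}$. New Lyapunov exponent: $$\chi^+_N(f,x,v):=\limsup_{n\to+\infty}\ \lim_{\delta\to0}\ \frac1n\log\sup_{y\in(B_x(\delta,n)\setminus\{x\})\cap L_{x,v}}\Delta(f,n,x,y).$$ Usual Lyapunov exponent, for $f$ differentiable: $\chi^+(f,x,v):=\limsup_{n\to\infty}\frac1n\log\|Df^n_x\cdot v\|$. Values are in $[-\infty,+\infty]$, with $\log 0=-\infty$, $\log(+\infty)=+\infty$, and the supremum over the empty set (which occurs only for $v=0$) equal to $0$. *)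

theory Defs
  imports "HOL-Analysis.Analysis"
begin

section \<open>Smooth maps between Euclidean spaces\<close>

text \<open>Intended for open sets \<open>S\<close>.\<close>

primrec Ck_on :: "nat \<Rightarrow> 'a::real_normed_vector set \<Rightarrow> ('a \<Rightarrow> 'b::real_normed_vector) \<Rightarrow> bool" where
  "Ck_on 0 S f \<longleftrightarrow> continuous_on S f"
| "Ck_on (Suc k) S f \<longleftrightarrow>
     (\<forall>x\<in>S. f differentiable (at x)) \<and> (\<forall>v. Ck_on k S (\<lambda>x. frechet_derivative f (at x) v))"

definition smooth_on :: "'a::real_normed_vector set \<Rightarrow> ('a \<Rightarrow> 'b::real_normed_vector) \<Rightarrow> bool" where
  "smooth_on S f \<longleftrightarrow> (\<forall>k. Ck_on k S f)"


section \<open>Smooth surfaces\<close>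

text \<open>The surface is the whole type \<open>'a\<close>. A chart is a domain together with a map; the values of
  the map outside the domain are irrelevant.\<close>

type_synonym 'a chart = "'a set \<times> ('a \<Rightarrow> real^2)"

abbreviation chart_dom :: "'a chart \<Rightarrow> 'a set" where "chart_dom \<equiv> fst"
abbreviation chart_map :: "'a chart \<Rightarrow> 'a \<Rightarrow> real^2" where "chart_map \<equiv> snd"

definition chart_img :: "'a chart \<Rightarrow> (real^2) set" where
  "chart_img c = chart_map c ` chart_dom c"

definition chart_inv :: "'a chart \<Rightarrow> real^2 \<Rightarrow> 'a" where
  "chart_inv c = inv_into (chart_dom c) (chart_map c)"

definition is_chart :: "'a::topological_space chart \<Rightarrow> bool" where
  "is_chart c \<longleftrightarrow> open (chart_dom c) \<and> open (chart_img c) \<and>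
     homeomorphism (chart_dom c) (chart_img c) (chart_map c) (chart_inv c)"

definition smooth_transition :: "'a chart \<Rightarrow> 'a chart \<Rightarrow> bool" where
  "smooth_transition c d \<longleftrightarrow>
     smooth_on (chart_map c ` (chart_dom c \<inter> chart_dom d)) (chart_map d \<circ> chart_inv c)"

definition smooth_structure :: "'a::topological_space chart set \<Rightarrow> bool" where
  "smooth_structure A \<longleftrightarrow>
     (\<forall>c\<in>A. is_chart c) \<and> (\<Union>c\<in>A. chart_dom c) = UNIV \<and>
     (\<forall>c\<in>A. \<forall>d\<in>A. smooth_transition c d) \<and>
     (\<forall>d. is_chart d \<and> (\<forall>c\<in>A. smooth_transition c d \<and> smooth_transition d c) \<longrightarrow> d \<in> A)"

definition charts_at :: "'a chart set \<Rightarrow> 'a \<Rightarrow> 'a chart set" where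
  "charts_at A x = {c \<in> A. x \<in> chart_dom c}"


section \<open>Tangent vectors\<close>

text \<open>A tangent vector at \<open>x\<close> is the family of its representatives in all charts at \<open>x\<close>,
  related by the derivatives of the coordinate changes, and set to 0 at all other charts.
  Thus \<open>v c\<close> is the derivative of the chart \<open>c\<close> applied to \<open>v\<close>.\<close>

type_synonym 'a tvec = "'a chart \<Rightarrow> real^2"

definition transition_deriv :: "'a chart \<Rightarrow> 'a chart \<Rightarrow> 'a \<Rightarrow> real^2 \<Rightarrow> real^2" where
  "transition_deriv c d x = frechet_derivative (chart_map d \<circ> chart_inv c) (at (chart_map c x))"

definition tangent_space :: "'a chart set \<Rightarrow> 'a \<Rightarrow> 'a tvec set" where
  "tangent_space A x = {v.
     (\<forall>c\<in>charts_at A x. \<forall>d\<in>charts_at A x. v d = transition_deriv c d x (v c)) \<and>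
     (\<forall>c. c \<notin> charts_at A x \<longrightarrow> v c = 0)}"

text \<open>The tangent vector at \<open>x\<close> represented by \<open>a\<close> in the chart \<open>c\<close>.\<close>

definition coord_vec :: "'a chart set \<Rightarrow> 'a chart \<Rightarrow> 'a \<Rightarrow> real^2 \<Rightarrow> 'a tvec" where
  "coord_vec A c x a = (\<lambda>d. if d \<in> charts_at A x then transition_deriv c d x a else 0)"

text \<open>Continuity has to be required separately, since a chart map is
  unconstrained outside its domain.\<close>

definition differentiable_map :: "'a::topological_space chart set \<Rightarrow> ('a \<Rightarrow> 'a) \<Rightarrow> bool" where
  "differentiable_map A f \<longleftrightarrow> continuous_on UNIV f \<and>
     (\<forall>x. \<forall>c\<in>charts_at A x. \<forall>d\<in>charts_at A (f x).
        (chart_map d \<circ> f \<circ> chart_inv c) differentiable (at (chart_map c x)))"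

text \<open>The derivative of \<open>f\<close> at \<open>x\<close>. For differentiable \<open>f\<close> and \<open>v\<close> in the tangent space at \<open>x\<close>
  it does not depend on the choice of the chart \<open>c\<close> at \<open>x\<close>.\<close>

definition tangent_map :: "'a chart set \<Rightarrow> ('a \<Rightarrow> 'a) \<Rightarrow> 'a \<Rightarrow> 'a tvec \<Rightarrow> 'a tvec" where
  "tangent_map A f x v = (\<lambda>d. if d \<in> charts_at A (f x) then
       (let c = (SOME c. c \<in> charts_at A x) in
          frechet_derivative (chart_map d \<circ> f \<circ> chart_inv c) (at (chart_map c x)) (v c))
     else 0)"


section \<open>Riemannian metrics, area forms and the induced measure\<close>

text \<open>A field of bilinear forms on the tangent spaces. As \<open>coord_vec A c x\<close> is the linear
  isomorphism from the plane onto the tangent space at \<open>x\<close> given by the chart \<open>c\<close>,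
  bilinearity and smoothness can be expressed through it.\<close>

type_synonym 'a form2 = "'a \<Rightarrow> 'a tvec \<Rightarrow> 'a tvec \<Rightarrow> real"

definition smooth_form2 :: "'a chart set \<Rightarrow> 'a form2 \<Rightarrow> bool" where
  "smooth_form2 A g \<longleftrightarrow>
     (\<forall>x. \<forall>c\<in>charts_at A x. bilinear (\<lambda>a b. g x (coord_vec A c x a) (coord_vec A c x b))) \<and>
     (\<forall>c\<in>A. \<forall>a b. smooth_on (chart_img c)
        (\<lambda>p. g (chart_inv c p) (coord_vec A c (chart_inv c p) a) (coord_vec A c (chart_inv c p) b)))"

definition riemannian_metric :: "'a chart set \<Rightarrow> 'a form2 \<Rightarrow> bool" where
  "riemannian_metric A g \<longleftrightarrow> smooth_form2 A g \<and>
     (\<forall>x. \<forall>u\<in>tangent_space A x. \<forall>w\<in>tangent_space A x. g x u w = g x w u) \<and>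
     (\<forall>x. \<forall>u\<in>tangent_space A x. u \<noteq> (\<lambda>_. 0) \<longrightarrow> g x u u > 0)"

definition area_form :: "'a chart set \<Rightarrow> 'a form2 \<Rightarrow> bool" where
  "area_form A \<omega> \<longleftrightarrow> smooth_form2 A \<omega> \<and>
     (\<forall>x. \<forall>u\<in>tangent_space A x. \<forall>w\<in>tangent_space A x. \<omega> x u w = - \<omega> x w u) \<and>
     (\<forall>x. \<exists>u\<in>tangent_space A x. \<exists>w\<in>tangent_space A x. \<omega> x u w \<noteq> 0)"

definition area_density :: "'a chart set \<Rightarrow> 'a form2 \<Rightarrow> 'a chart \<Rightarrow> real^2 \<Rightarrow> real" where
  "area_density A \<omega> c p =
     \<bar>\<omega> (chart_inv c p) (coord_vec A c (chart_inv c p) (axis 1 1)) (coord_vec A c (chart_inv c p) (axis 2 1))\<bar>"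

definition area_measure :: "'a::topological_space chart set \<Rightarrow> 'a form2 \<Rightarrow> 'a measure \<Rightarrow> bool" where
  "area_measure A \<omega> lam \<longleftrightarrow> sets lam = sets borel \<and>
     (\<forall>c\<in>A. \<forall>E\<in>sets borel. E \<subseteq> chart_dom c \<longrightarrow>
        emeasure lam E = (\<integral>\<^sup>+p\<in>chart_map c ` E. ennreal (area_density A \<omega> c p) \<partial>lborel))"

definition conservative_chart :: "'a measure \<Rightarrow> 'a chart \<Rightarrow> bool" where
  "conservative_chart lam c \<longleftrightarrow>
     distr (restrict_space lam (chart_dom c)) lborel (chart_map c) =
     density lborel (indicator (chart_img c))"


section \<open>The Riemannian distance\<close>

text \<open>At the end points of the interval the one-sided derivatives are used.\<close>

definition C1_curve_on :: "'a::topological_space chart set \<Rightarrow> real \<Rightarrow> real \<Rightarrow> (real \<Rightarrow> 'a) \<Rightarrow> bool" where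
  "C1_curve_on A a b \<gamma> \<longleftrightarrow> continuous_on {a..b} \<gamma> \<and>
     (\<forall>c\<in>A.
        (\<forall>t\<in>{a..b} \<inter> \<gamma> -` chart_dom c. (chart_map c \<circ> \<gamma>) differentiable (at t within {a..b})) \<and>
        continuous_on ({a..b} \<inter> \<gamma> -` chart_dom c)
          (\<lambda>t. vector_derivative (chart_map c \<circ> \<gamma>) (at t within {a..b})))"

definition piecewise_C1_curve :: "'a::topological_space chart set \<Rightarrow> (real \<Rightarrow> 'a) \<Rightarrow> bool" where
  "piecewise_C1_curve A \<gamma> \<longleftrightarrow> continuous_on {0..1} \<gamma> \<and>
     (\<exists>K. finite K \<and> {0, 1} \<subseteq> K \<and> K \<subseteq> {0..1} \<and>
        (\<forall>a\<in>K. \<forall>b\<in>K. a < b \<and> {a<..<b} \<inter> K = {} \<longrightarrow> C1_curve_on A a b \<gamma>))"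

definition velocity :: "'a chart set \<Rightarrow> (real \<Rightarrow> 'a) \<Rightarrow> real \<Rightarrow> 'a tvec" where
  "velocity A \<gamma> t =
     (\<lambda>c. if c \<in> charts_at A (\<gamma> t) then vector_derivative (chart_map c \<circ> \<gamma>) (at t) else 0)"

text \<open>The integrand is meaningful except at the finitely many break points.\<close>

definition curve_length :: "'a chart set \<Rightarrow> 'a form2 \<Rightarrow> (real \<Rightarrow> 'a) \<Rightarrow> ennreal" where
  "curve_length A g \<gamma> =
     (\<integral>\<^sup>+t\<in>{0..1}. ennreal (sqrt (g (\<gamma> t) (velocity A \<gamma> t) (velocity A \<gamma> t))) \<partial>lborel)"

text \<open>On a connected surface all values are finite.\<close>

definition riem_dist :: "'a::topological_space chart set \<Rightarrow> 'a form2 \<Rightarrow> 'a \<Rightarrow> 'a \<Rightarrow> ennreal" where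
  "riem_dist A g x y =
     (INF \<gamma>\<in>{\<gamma>. piecewise_C1_curve A \<gamma> \<and> \<gamma> 0 = x \<and> \<gamma> 1 = y}. curve_length A g \<gamma>)"

definition dyn_ball ::
  "'a::topological_space chart set \<Rightarrow> 'a form2 \<Rightarrow> ('a \<Rightarrow> 'a) \<Rightarrow> 'a \<Rightarrow> real \<Rightarrow> nat \<Rightarrow> 'a set" where
  "dyn_ball A g f x \<delta> n = {y. \<forall>j\<le>n. riem_dist A g ((f ^^ j) x) ((f ^^ j) y) < ennreal \<delta>}"


section \<open>Lyapunov exponents\<close>

text \<open>The logarithm from \<open>[0, \<infinity>]\<close> to \<open>[-\<infinity>, \<infinity>]\<close>.\<close>

definition eln :: "ennreal \<Rightarrow> ereal" where
  "eln a = (if a = 0 then -\<infinity> else if a = \<infinity> then \<infinity> else ereal (ln (enn2real a)))"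

text \<open>Below, \<open>\<phi> 1, \<dots>, \<phi> k\<close> is a finite atlas.\<close>

definition first_chart :: "nat \<Rightarrow> (nat \<Rightarrow> 'a chart) \<Rightarrow> 'a \<Rightarrow> 'a chart" where
  "first_chart k \<phi> x = \<phi> (LEAST i. i \<in> {1..k} \<and> x \<in> chart_dom (\<phi> i))"

definition tnorm :: "nat \<Rightarrow> (nat \<Rightarrow> 'a chart) \<Rightarrow> 'a \<Rightarrow> 'a tvec \<Rightarrow> real" where
  "tnorm k \<phi> x v = norm (v (first_chart k \<phi> x))"

definition tangent_line :: "nat \<Rightarrow> (nat \<Rightarrow> 'a chart) \<Rightarrow> 'a \<Rightarrow> 'a tvec \<Rightarrow> 'a set" where
  "tangent_line k \<phi> x v = (let c = first_chart k \<phi> x in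
     {y \<in> chart_dom c. \<exists>s. chart_map c y = chart_map c x + s *\<^sub>R v c})"

text \<open>Meaningful only if \<open>y\<close> and \<open>(f ^^ n) y\<close> lie in the domains of the first charts at \<open>x\<close> and at
  \<open>(f ^^ n) x\<close>, which for \<open>y\<close> in \<open>dyn_ball A g f x \<delta> n\<close> is the case as soon as \<open>\<delta>\<close> is small.\<close>

definition diff_quot ::
  "nat \<Rightarrow> (nat \<Rightarrow> 'a chart) \<Rightarrow> ('a \<Rightarrow> 'a) \<Rightarrow> nat \<Rightarrow> 'a \<Rightarrow> 'a \<Rightarrow> real" where
  "diff_quot k \<phi> f n x y =
     (let c = first_chart k \<phi> x; d = first_chart k \<phi> ((f ^^ n) x) in
        norm (chart_map d ((f ^^ n) x) - chart_map d ((f ^^ n) y)) /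
        norm (chart_map c x - chart_map c y))"

text \<open>The supremum is taken in \<open>ennreal\<close>, so that it is 0 over the empty set.\<close>

definition new_lyapunov ::
  "'a::topological_space chart set \<Rightarrow> 'a form2 \<Rightarrow> nat \<Rightarrow> (nat \<Rightarrow> 'a chart) \<Rightarrow>
   ('a \<Rightarrow> 'a) \<Rightarrow> 'a \<Rightarrow> 'a tvec \<Rightarrow> ereal" where
  "new_lyapunov A g k \<phi> f x v = limsup (\<lambda>n. Lim (at_right 0) (\<lambda>\<delta>.
     ereal (1 / real n) *
     eln (SUP y\<in>(dyn_ball A g f x \<delta> n - {x}) \<inter> tangent_line k \<phi> x v.
            ennreal (diff_quot k \<phi> f n x y))))"

definition usual_lyapunov ::
  "'a chart set \<Rightarrow> nat \<Rightarrow> (nat \<Rightarrow> 'a chart) \<Rightarrow> ('a \<Rightarrow> 'a) \<Rightarrow> 'a \<Rightarrow> 'a tvec \<Rightarrow> ereal" where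
  "usual_lyapunov A k \<phi> f x v = limsup (\<lambda>n. ereal (1 / real n) *
     eln (ennreal (tnorm k \<phi> ((f ^^ n) x) (tangent_map A (f ^^ n) x v))))"

end

theory Submission
  imports Defs
begin

text \<open>In a chart at \<open>x\<close> the metric is comparable to the Euclidean one on compact sets, so the
  Riemannian distance induces the topology of the surface. Hence the dynamical balls at \<open>x\<close> are
  neighbourhoods of \<open>x\<close> that shrink to \<open>x\<close> as \<open>\<delta>\<close> tends to 0. For fixed \<open>n\<close> and \<open>v \<noteq> 0\<close> the difference
  quotients along the line spanned by \<open>v\<close> converge to \<open>\<parallel>Df\<^sup>n v\<parallel> / \<parallel>v\<parallel>\<close>, and so do their suprema over
  the shrinking balls. The factor \<open>1 / \<parallel>v\<parallel>\<close> disappears in the limes superior, since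
  \<open>ln \<parallel>v\<parallel> / n\<close> tends to 0. For \<open>v = 0\<close> both exponents come from the constant \<open>ln 0\<close>.\<close>

section \<open>Charts and tangent vectors\<close>

text \<open>The Hausdorff class \<open>t2_space\<close> makes compact images of coordinate discs
  closed, which \<open>riem_dist_small\<close> relies on.\<close>

locale riemannian_surface =
  fixes A :: "'a::t2_space chart set" and g :: "'a form2"
  assumes smooth: "smooth_structure A" and metric: "riemannian_metric A g"
begin

lemma charts_at_iff: "c \<in> charts_at A x \<longleftrightarrow> c \<in> A \<and> x \<in> chart_dom c"
  by (simp add: charts_at_def)

lemma charts_at_nonempty: "\<exists>c. c \<in> charts_at A x"
proof -
  have "x \<in> (\<Union>c\<in>A. chart_dom c)" using smooth by (auto simp: smooth_structure_def)
  then show ?thesis by (auto simp: charts_at_iff)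
qed

lemma is_chart: "c \<in> A \<Longrightarrow> is_chart c"
  using smooth by (auto simp: smooth_structure_def)

lemma open_chart_dom: "c \<in> A \<Longrightarrow> open (chart_dom c)"
  and open_chart_img: "c \<in> A \<Longrightarrow> open (chart_img c)"
  and chart_inv_map: "c \<in> A \<Longrightarrow> x \<in> chart_dom c \<Longrightarrow> chart_inv c (chart_map c x) = x"
  and chart_map_inv: "c \<in> A \<Longrightarrow> p \<in> chart_img c \<Longrightarrow> chart_map c (chart_inv c p) = p"
  and continuous_chart_map: "c \<in> A \<Longrightarrow> continuous_on (chart_dom c) (chart_map c)"
  and continuous_chart_inv: "c \<in> A \<Longrightarrow> continuous_on (chart_img c) (chart_inv c)"
  using is_chart[of c] by (auto simp: is_chart_def homeomorphism_def)

lemma chart_map_in_img: "(x::'a) \<in> chart_dom c \<Longrightarrow> chart_map c x \<in> chart_img c"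
  by (auto simp: chart_img_def)

lemma chart_inv_in_dom: "c \<in> A \<Longrightarrow> p \<in> chart_img c \<Longrightarrow> chart_inv c p \<in> chart_dom c"
  by (auto simp: chart_img_def chart_inv_map)

lemma isCont_chart_map: "c \<in> A \<Longrightarrow> x \<in> chart_dom c \<Longrightarrow> isCont (chart_map c) x"
  using continuous_chart_map open_chart_dom continuous_on_eq_continuous_at by blast

lemma isCont_chart_inv: "c \<in> A \<Longrightarrow> p \<in> chart_img c \<Longrightarrow> isCont (chart_inv c) p"
  using continuous_chart_inv open_chart_img continuous_on_eq_continuous_at by blast

text \<open>\<open>chart_inv c\<close> is arbitrary off the image of the chart; openness of that
  image makes it a genuine inverse near \<open>chart_map c x\<close>, and its continuity there does
  the rest.\<close>

lemma eventually_chart_inv: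
  assumes "c \<in> charts_at A x" "open U" "x \<in> U"
  shows "eventually (\<lambda>p. p \<in> chart_img c \<and> chart_inv c p \<in> U) (nhds (chart_map c x))"
proof -
  have c: "c \<in> A" "x \<in> chart_dom c" using assms by (auto simp: charts_at_iff)
  have i: "chart_map c x \<in> chart_img c" using c(2) by (rule chart_map_in_img)
  have "eventually (\<lambda>p. p \<in> chart_img c) (nhds (chart_map c x))"
    using open_chart_img[OF c(1)] i eventually_nhds_in_open by blast
  moreover have "filterlim (chart_inv c) (nhds x) (nhds (chart_map c x))"
    using isCont_chart_inv[OF c(1) i] chart_inv_map[OF c] isContD tendsto_at_iff_tendsto_nhds
    by metis
  then have "eventually (\<lambda>p. chart_inv c p \<in> U) (nhds (chart_map c x))"
    using assms(2,3) topological_tendstoD by fastforce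
  ultimately show ?thesis by (rule eventually_conj)
qed

section \<open>Coordinate changes and the chain rule through a chart\<close>

lemma transition_smooth:
  "c \<in> A \<Longrightarrow> d \<in> A \<Longrightarrow>
    smooth_on (chart_map c ` (chart_dom c \<inter> chart_dom d)) (chart_map d \<circ> chart_inv c)"
  using smooth unfolding smooth_structure_def smooth_transition_def by blast

lemma transition_has_derivative:
  assumes "c \<in> charts_at A x" "d \<in> charts_at A x"
  shows "(chart_map d \<circ> chart_inv c has_derivative transition_deriv c d x) (at (chart_map c x))"
proof -
  have "Ck_on (Suc 0) (chart_map c ` (chart_dom c \<inter> chart_dom d)) (chart_map d \<circ> chart_inv c)"
    using transition_smooth assms unfolding smooth_on_def charts_at_iff by blast
  then have "(chart_map d \<circ> chart_inv c) differentiable (at (chart_map c x))"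
    using assms by (auto simp: charts_at_iff)
  then show ?thesis by (simp add: transition_deriv_def frechet_derivative_works)
qed

lemma linear_transition_deriv:
  "c \<in> charts_at A x \<Longrightarrow> d \<in> charts_at A x \<Longrightarrow> linear (transition_deriv c d x)"
  using transition_has_derivative has_derivative_linear by blast

text \<open>The factorization of \<open>F \<circ> h\<close> through the chart \<open>e\<close> is
  valid only while \<open>h\<close> stays in its domain; continuity of \<open>h\<close> guarantees
  this near \<open>t\<close>. Here \<open>h\<close> will be an inverse chart, an iterate read in a
  chart, or a curve.\<close>

lemma has_derivative_through_chart:
  fixes F :: "'a \<Rightarrow> 'b::real_normed_vector" and h :: "'c::real_normed_vector \<Rightarrow> 'a"
  assumes h: "continuous (at t within S) h" "t \<in> S"
    and e: "e \<in> charts_at A (h t)"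
    and E: "(chart_map e \<circ> h has_derivative E) (at t within S)"
    and D: "(F \<circ> chart_inv e has_derivative D) (at (chart_map e (h t)))"
  shows "(F \<circ> h has_derivative D \<circ> E) (at t within S)"
proof -
  have eA: "e \<in> A" "h t \<in> chart_dom e" using e by (auto simp: charts_at_iff)
  have "((F \<circ> chart_inv e) \<circ> (chart_map e \<circ> h) has_derivative D \<circ> E) (at t within S)"
    using E D by (intro diff_chain_within) (auto intro: has_derivative_at_withinI)
  moreover have "eventually (\<lambda>s. h s \<in> chart_dom e) (at t within S)"
    using h(1) open_chart_dom[OF eA(1)] eA(2) topological_tendstoD
    unfolding continuous_within by blast
  then have "eventually (\<lambda>s. ((F \<circ> chart_inv e) \<circ> (chart_map e \<circ> h)) s = (F \<circ> h) s) (at t within S)"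
    by eventually_elim (simp add: chart_inv_map eA)
  ultimately show ?thesis
    by (rule has_derivative_transform_eventually) (use h eA in \<open>auto simp: chart_inv_map\<close>)
qed

lemma change_of_chart:
  fixes F :: "'a \<Rightarrow> 'b::real_normed_vector"
  assumes c: "c \<in> charts_at A x" and e: "e \<in> charts_at A x"
    and D: "(F \<circ> chart_inv e has_derivative D) (at (chart_map e x))"
  shows "(F \<circ> chart_inv c has_derivative D \<circ> transition_deriv c e x) (at (chart_map c x))"
proof -
  have cA: "c \<in> A" "x \<in> chart_dom c" using c by (auto simp: charts_at_iff)
  show ?thesis
    using has_derivative_through_chart[of "chart_map c x" UNIV "chart_inv c" e "transition_deriv c e x" F D]
      transition_has_derivative[OF c e] e D isCont_chart_inv[OF cA(1) chart_map_in_img[OF cA(2)]]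
    by (simp add: chart_inv_map[OF cA])
qed

text \<open>The cocycle rule: both sides are derivatives of the same coordinate change, once
  directly and once through \<open>e\<close>, and derivatives are unique.\<close>

lemma transition_deriv_trans:
  assumes "c \<in> charts_at A x" "e \<in> charts_at A x" "d \<in> charts_at A x"
  shows "transition_deriv e d x (transition_deriv c e x a) = transition_deriv c d x a"
proof -
  have "(chart_map d \<circ> chart_inv c has_derivative transition_deriv e d x \<circ> transition_deriv c e x)
      (at (chart_map c x))"
    using change_of_chart[OF assms(1,2) transition_has_derivative[OF assms(2,3)]] .
  from has_derivative_unique[OF this transition_has_derivative[OF assms(1,3)]]
  show ?thesis by (metis comp_apply)
qed

text \<open>The composition is the identity only on the chart image, but that is a neighbourhood of
  the point, so the derivative is the identity.\<close>

lemma transition_deriv_refl: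
  assumes "c \<in> charts_at A x"
  shows "transition_deriv c c x a = a"
proof -
  have "eventually (\<lambda>p. p \<in> chart_img c \<and> chart_inv c p \<in> UNIV) (nhds (chart_map c x))"
    using eventually_chart_inv[OF assms, of UNIV] by simp
  then have ev: "eventually (\<lambda>p. p = (chart_map c \<circ> chart_inv c) p) (nhds (chart_map c x))"
    by eventually_elim (use assms in \<open>auto simp: chart_map_inv charts_at_iff\<close>)
  have "((chart_map c \<circ> chart_inv c) has_derivative (\<lambda>a. a)) (at (chart_map c x))"
    by (rule has_derivative_transform_eventually[OF has_derivative_ident])
      (use ev eventually_nhds_x_imp_x[OF ev] in \<open>simp_all add: eventually_nhds_conv_at\<close>)
  from has_derivative_unique[OF this transition_has_derivative[OF assms assms]]
  show ?thesis by metis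
qed

text \<open>The compatibility of representatives is exactly the cocycle rule.\<close>

lemma coord_vec_in_tangent_space:
  "c \<in> charts_at A x \<Longrightarrow> coord_vec A c x a \<in> tangent_space A x"
  by (auto simp: tangent_space_def coord_vec_def transition_deriv_trans)

lemma coord_vec_eq_0_iff:
  assumes "c \<in> charts_at A x"
  shows "coord_vec A c x a = (\<lambda>_. 0) \<longleftrightarrow> a = 0"
proof
  assume "coord_vec A c x a = (\<lambda>_. 0)"
  then show "a = 0"
    using assms transition_deriv_refl unfolding coord_vec_def by metis
next
  assume "a = 0"
  then show "coord_vec A c x a = (\<lambda>_. 0)"
    using linear_0[OF linear_transition_deriv[OF assms]] by (simp add: coord_vec_def fun_eq_iff)
qed

section \<open>Differentiable self-maps, their iterates, and velocities of curves\<close>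

lemma differentiable_mapD:
  assumes "differentiable_map A h" "c \<in> charts_at A x" "d \<in> charts_at A (h x)"
  obtains D where "(chart_map d \<circ> h \<circ> chart_inv c has_derivative D) (at (chart_map c x))"
  using assms unfolding differentiable_map_def differentiable_def by blast

lemma differentiable_map_id: "differentiable_map A (\<lambda>x. x)"
proof -
  have "(chart_map d \<circ> (\<lambda>x. x) \<circ> chart_inv c) differentiable (at (chart_map c x))"
    if "c \<in> charts_at A x" "d \<in> charts_at A x" for c d x
    using transition_has_derivative[OF that] by (auto simp: differentiable_def o_def)
  then show ?thesis unfolding differentiable_map_def by (auto simp del: split_paired_All)
qed

lemma differentiable_map_funpow:
  assumes f: "differentiable_map A f"
  shows "differentiable_map A (f ^^ n)"
proof (induction n)
  case 0
  show ?case using differentiable_map_id by (simp add: id_def)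
next
  case (Suc n)
  have cf: "continuous_on UNIV (f ^^ n)" "continuous_on UNIV f"
    using Suc f by (auto simp: differentiable_map_def)
  have "(chart_map d \<circ> (f ^^ Suc n) \<circ> chart_inv c) differentiable (at (chart_map c x))"
    if c: "c \<in> charts_at A x" and d: "d \<in> charts_at A ((f ^^ Suc n) x)" for x c d
  proof -
    have cA: "c \<in> A" "x \<in> chart_dom c" using c by (auto simp: charts_at_iff)
    obtain e where e: "e \<in> charts_at A ((f ^^ n) x)" using charts_at_nonempty by blast
    obtain E where E: "(chart_map e \<circ> (f ^^ n) \<circ> chart_inv c has_derivative E) (at (chart_map c x))"
      using differentiable_mapD[OF Suc c e] .
    obtain D where D: "(chart_map d \<circ> f \<circ> chart_inv e has_derivative D) (at (chart_map e ((f ^^ n) x)))"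
      using differentiable_mapD[OF f e, of d] d by auto
    \<comment> \<open>Continuity keeps nearby orbits in the domain of the intermediate chart
      \<open>e\<close>, so the chain rule through \<open>e\<close> applies.\<close>
    have "isCont ((f ^^ n) \<circ> chart_inv c) (chart_map c x)"
      using cf(1) isCont_chart_inv[OF cA(1) chart_map_in_img[OF cA(2)]]
      by (intro continuous_at_compose) (auto simp: continuous_on_eq_continuous_at)
    then have "((chart_map d \<circ> f) \<circ> ((f ^^ n) \<circ> chart_inv c) has_derivative D \<circ> E) (at (chart_map c x))"
      using has_derivative_through_chart[of "chart_map c x" UNIV "(f ^^ n) \<circ> chart_inv c" e E "chart_map d \<circ> f" D]
        e E D by (simp add: chart_inv_map[OF cA] o_assoc)
    then show ?thesis by (auto simp: differentiable_def o_assoc)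
  qed
  moreover have "continuous_on UNIV (f ^^ Suc n)"
    using continuous_on_compose[OF cf(1) continuous_on_subset[OF cf(2)]] by simp
  ultimately show ?case unfolding differentiable_map_def by blast
qed

text \<open>\<open>tangent_map\<close> is computed in the chart \<open>e\<close> picked by
  \<open>SOME\<close>. Passing from \<open>e\<close> to \<open>c\<close> composes the derivative
  with a transition derivative, and the same transition relates the two representatives of
  \<open>v\<close>.\<close>

lemma tangent_map_chart:
  assumes h: "differentiable_map A h" and v: "v \<in> tangent_space A x"
    and c: "c \<in> charts_at A x" and d: "d \<in> charts_at A (h x)"
    and D: "(chart_map d \<circ> h \<circ> chart_inv c has_derivative D) (at (chart_map c x))"
  shows "tangent_map A h x v d = D (v c)"
proof -
  define e where "e = (SOME c. c \<in> charts_at A x)"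
  have e: "e \<in> charts_at A x" unfolding e_def using c by (rule someI)
  obtain E where E: "(chart_map d \<circ> h \<circ> chart_inv e has_derivative E) (at (chart_map e x))"
    using differentiable_mapD[OF h e d] .
  have "D = E \<circ> transition_deriv c e x"
    using has_derivative_unique[OF D] change_of_chart[OF c e E] by simp
  moreover have "v e = transition_deriv c e x (v c)"
    using v c e unfolding tangent_space_def by blast
  ultimately show ?thesis
    using d frechet_derivative_at[OF E] by (simp add: tangent_map_def e_def[symmetric])
qed

text \<open>A derivative in one chart determines those in all other charts at the point by the chain
  rule.\<close>

lemma velocity_eq_coord_vec:
  assumes "isCont \<gamma> t" and c: "c \<in> charts_at A (\<gamma> t)"
    and w: "(chart_map c \<circ> \<gamma> has_vector_derivative w) (at t)"
  shows "velocity A \<gamma> t = coord_vec A c (\<gamma> t) w"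
proof
  fix d
  show "velocity A \<gamma> t d = coord_vec A c (\<gamma> t) w d"
  proof (cases "d \<in> charts_at A (\<gamma> t)")
    case True
    have "(chart_map d \<circ> \<gamma> has_derivative transition_deriv c d (\<gamma> t) \<circ> (\<lambda>s. s *\<^sub>R w)) (at t)"
      using has_derivative_through_chart[of t UNIV \<gamma> c "\<lambda>s. s *\<^sub>R w" "chart_map d"]
        assms transition_has_derivative[OF c True] by (simp add: has_vector_derivative_def)
    then have "(chart_map d \<circ> \<gamma> has_vector_derivative transition_deriv c d (\<gamma> t) w) (at t)"
      using linear_cmul[OF linear_transition_deriv[OF c True]]
      by (simp add: has_vector_derivative_def o_def)
    then show ?thesis
      using True by (simp add: velocity_def coord_vec_def vector_derivative_at)
  qed (simp add: velocity_def coord_vec_def)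
qed

section \<open>The metric in a chart\<close>

text \<open>The metric tensor in coordinates, in precisely the form whose smoothness
  \<open>smooth_form2\<close> demands.\<close>

definition local_metric :: "'a chart \<Rightarrow> real^2 \<Rightarrow> real^2 \<Rightarrow> real^2 \<Rightarrow> real" where
  "local_metric c p a b =
     g (chart_inv c p) (coord_vec A c (chart_inv c p) a) (coord_vec A c (chart_inv c p) b)"

lemma chart_inv_charts_at: "c \<in> A \<Longrightarrow> p \<in> chart_img c \<Longrightarrow> c \<in> charts_at A (chart_inv c p)"
  by (simp add: charts_at_iff chart_inv_in_dom)

lemma bilinear_local_metric:
  "c \<in> A \<Longrightarrow> p \<in> chart_img c \<Longrightarrow> bilinear (local_metric c p)"
  using metric chart_inv_charts_at[of c p]
  by (simp add: riemannian_metric_def smooth_form2_def local_metric_def[abs_def])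

lemma local_metric_pos:
  assumes "c \<in> A" "p \<in> chart_img c" "a \<noteq> 0"
  shows "local_metric c p a a > 0"
proof -
  note c = chart_inv_charts_at[OF assms(1,2)]
  show ?thesis
    using metric coord_vec_in_tangent_space[OF c] coord_vec_eq_0_iff[OF c] assms(3)
    unfolding riemannian_metric_def local_metric_def by blast
qed

text \<open>Smoothness of the metric gives continuity in \<open>p\<close> for fixed vectors only.
  Expanding \<open>a\<close> in the basis turns this into joint continuity, since only finitely many
  coefficient functions occur.\<close>

lemma continuous_local_metric:
  assumes "c \<in> A"
  shows "continuous_on (chart_img c \<times> UNIV) (\<lambda>(p, a). local_metric c p a a)"
proof -
  have cont: "continuous_on (chart_img c) (\<lambda>p. local_metric c p a b)" for a b
  proof -
    have "Ck_on 0 (chart_img c) (\<lambda>p. local_metric c p a b)"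
      using metric assms
      unfolding riemannian_metric_def smooth_form2_def smooth_on_def local_metric_def by blast
    then show ?thesis by simp
  qed
  have "local_metric c p a a = (\<Sum>i\<in>Basis. \<Sum>j\<in>Basis. (a \<bullet> i) * (a \<bullet> j) * local_metric c p i j)"
    if "p \<in> chart_img c" for p a
  proof -
    note b = bilinear_local_metric[OF assms that]
    have "local_metric c p a a = local_metric c p (\<Sum>i\<in>Basis. (a \<bullet> i) *\<^sub>R i) (\<Sum>j\<in>Basis. (a \<bullet> j) *\<^sub>R j)"
      by (simp add: euclidean_representation)
    also have "\<dots> = (\<Sum>(i,j)\<in>Basis\<times>Basis. local_metric c p ((a \<bullet> i) *\<^sub>R i) ((a \<bullet> j) *\<^sub>R j))"
      by (rule bilinear_sum[OF b])
    finally show ?thesis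
      by (simp add: sum.cartesian_product bilinear_lmul[OF b] bilinear_rmul[OF b] mult_ac)
  qed
  then have eq: "(\<lambda>(p, a). local_metric c p a a) z =
      (\<Sum>i\<in>Basis. \<Sum>j\<in>Basis. (snd z \<bullet> i) * (snd z \<bullet> j) * local_metric c (fst z) i j)"
    if "z \<in> chart_img c \<times> UNIV" for z
    using that by auto
  have "continuous_on (chart_img c \<times> UNIV)
      (\<lambda>z. \<Sum>i\<in>Basis. \<Sum>j\<in>Basis. (snd z \<bullet> i) * (snd z \<bullet> j) * local_metric c (fst z) i j)"
    by (intro continuous_intros continuous_on_compose2[OF cont]) auto
  then show ?thesis by (subst continuous_on_cong[OF refl eq])
qed

text \<open>By homogeneity only unit vectors matter; on the compact product of \<open>C\<close> with
  the unit circle the positive continuous function \<open>h\<close> attains its extrema. The empty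
  \<open>C\<close> is split off because extrema need a point.\<close>

lemma local_metric_bounds:
  assumes c: "c \<in> A" and C: "compact C" "C \<subseteq> chart_img c"
  obtains m M where "m > 0" "M > 0"
    "\<And>p a. p \<in> C \<Longrightarrow> m * norm a \<le> sqrt (local_metric c p a a)"
    "\<And>p a. p \<in> C \<Longrightarrow> sqrt (local_metric c p a a) \<le> M * norm a"
proof (cases "C = {}")
  case True
  then show ?thesis using that[of 1 1] by auto
next
  case False
  define h where "h = (\<lambda>(p, a). sqrt (local_metric c p a a))"
  define K where "K = C \<times> sphere (0::real^2) 1"
  have K: "compact K" "K \<noteq> {}" "K \<subseteq> chart_img c \<times> UNIV"
    using C False by (auto simp: K_def compact_Times)
  have "continuous_on K (\<lambda>z. sqrt ((\<lambda>(p, a). local_metric c p a a) z))"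
    by (intro continuous_intros continuous_on_subset[OF continuous_local_metric[OF c] K(3)])
  then have h: "continuous_on K h" by (simp add: h_def case_prod_unfold)
  obtain z where z: "z \<in> K" "\<And>y. y \<in> K \<Longrightarrow> h z \<le> h y"
    using continuous_attains_inf[OF K(1,2) h] by blast
  obtain z' where z': "z' \<in> K" "\<And>y. y \<in> K \<Longrightarrow> h y \<le> h z'"
    using continuous_attains_sup[OF K(1,2) h] by blast
  have pos: "h y > 0" if "y \<in> K" for y
  proof -
    obtain p a where "y = (p, a)" "p \<in> chart_img c" "norm a = 1"
      using \<open>y \<in> K\<close> C by (cases y) (auto simp: K_def)
    then show ?thesis using local_metric_pos[OF c, of p a] by (force simp: h_def)
  qed
  have scale: "sqrt (local_metric c p a a) = norm a * h (p, sgn a)" and inK: "a \<noteq> 0 \<Longrightarrow> (p, sgn a) \<in> K"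
    if "p \<in> C" for p a
  proof -
    have b: "bilinear (local_metric c p)" using bilinear_local_metric c C that by blast
    have "local_metric c p (norm a *\<^sub>R sgn a) (norm a *\<^sub>R sgn a) = (norm a)\<^sup>2 * local_metric c p (sgn a) (sgn a)"
      by (simp only: bilinear_lmul[OF b] bilinear_rmul[OF b]) (simp add: power2_eq_square)
    moreover have "norm a *\<^sub>R sgn a = a" by (cases "a = 0") (simp_all add: sgn_div_norm)
    ultimately show "sqrt (local_metric c p a a) = norm a * h (p, sgn a)"
      by (simp add: h_def real_sqrt_mult)
    show "a \<noteq> 0 \<Longrightarrow> (p, sgn a) \<in> K" using that by (simp add: K_def norm_sgn)
  qed
  show ?thesis
  proof (rule that[of "h z" "h z'"])
    show "h z > 0" "h z' > 0" using pos z z' by auto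
    show "h z * norm a \<le> sqrt (local_metric c p a a)" if "p \<in> C" for p a
      using scale[OF that, of a] inK[OF that, of a] z(2)
      by (cases "a = 0") (auto simp: mult.commute intro: mult_left_mono)
    show "sqrt (local_metric c p a a) \<le> h z' * norm a" if "p \<in> C" for p a
      using scale[OF that, of a] inK[OF that, of a] z'(2)
      by (cases "a = 0") (auto simp: mult.commute intro: mult_left_mono)
  qed
qed

section \<open>The Riemannian distance and the topology\<close>

lemma riem_dist_segment:
  assumes c: "c \<in> A" and B: "open B" "convex B" "B \<subseteq> chart_img c"
    and p: "p \<in> B" and q: "q \<in> B"
    and M: "M \<ge> 0" "\<And>z a. z \<in> B \<Longrightarrow> sqrt (local_metric c z a a) \<le> M * norm a"
  shows "riem_dist A g (chart_inv c p) (chart_inv c q) \<le> ennreal (M * norm (q - p))"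
proof -
  \<comment> \<open>The competing curve is straight in coordinates; convexity keeps it in
    \<open>B\<close>, where the bound \<open>M\<close> holds.\<close>
  define l where "l = (\<lambda>t. p + t *\<^sub>R (q - p))"
  define \<gamma> where "\<gamma> = chart_inv c \<circ> l"
  have lB: "l t \<in> B" if "t \<in> {0..1}" for t
  proof -
    have "l t = (1 - t) *\<^sub>R p + t *\<^sub>R q" by (simp add: l_def algebra_simps)
    then show ?thesis using convexD[OF B(2) p q, of "1 - t" t] that by simp
  qed
  have l_img: "l t \<in> chart_img c" if "t \<in> {0..1}" for t using lB[OF that] B(3) by blast
  have l_deriv: "(l has_derivative (\<lambda>s. s *\<^sub>R (q - p))) (at t)" for t
    unfolding l_def by (auto intro!: derivative_eq_intros)
  have l_cont: "continuous_on S l" for S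
    unfolding l_def by (intro continuous_intros)
  have map_\<gamma>: "chart_map c (\<gamma> t) = l t" if "t \<in> {0..1}" for t
    using chart_map_inv[OF c l_img[OF that]] by (simp add: \<gamma>_def)
  have at_\<gamma>: "c \<in> charts_at A (\<gamma> t)" if "t \<in> {0..1}" for t
    using chart_inv_charts_at[OF c l_img[OF that]] by (simp add: \<gamma>_def)
  have isCont_\<gamma>: "isCont \<gamma> t" if "t \<in> {0..1}" for t
    unfolding \<gamma>_def using l_deriv isCont_chart_inv[OF c l_img[OF that]]
    by (intro continuous_at_compose) (auto intro: has_derivative_continuous)
  \<comment> \<open>The line \<open>l\<close> continues beyond the unit interval, so two-sided
    derivatives exist even at the end points and agree with the one-sided ones.\<close>
  have deriv: "(chart_map d \<circ> \<gamma> has_vector_derivative transition_deriv c d (\<gamma> t) (q - p)) (at t)"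
    if t: "t \<in> {0..1}" and d: "d \<in> charts_at A (\<gamma> t)" for t d
  proof -
    have "((chart_map d \<circ> chart_inv c) \<circ> l has_derivative
        transition_deriv c d (\<gamma> t) \<circ> (\<lambda>s. s *\<^sub>R (q - p))) (at t)"
      using transition_has_derivative[OF at_\<gamma>[OF t] d] l_deriv
      by (intro diff_chain_at) (simp_all add: map_\<gamma>[OF t])
    then show ?thesis
      using linear_cmul[OF linear_transition_deriv[OF at_\<gamma>[OF t] d]]
      by (simp add: has_vector_derivative_def o_def \<gamma>_def)
  qed
  have deriv_c: "(chart_map c \<circ> \<gamma> has_vector_derivative (q - p)) (at t)" if "t \<in> {0..1}" for t
    using deriv[OF that at_\<gamma>[OF that]] transition_deriv_refl[OF at_\<gamma>[OF that]] by simp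
  have \<gamma>_cont: "continuous_on {0..1} \<gamma>"
    using isCont_\<gamma> by (simp add: continuous_at_imp_continuous_on)
  have C1: "C1_curve_on A 0 1 \<gamma>"
    unfolding C1_curve_on_def
  proof (intro conjI ballI \<gamma>_cont)
    fix d t assume d: "d \<in> A" and t: "t \<in> {0..1} \<inter> \<gamma> -` chart_dom d"
    then have "d \<in> charts_at A (\<gamma> t)" by (simp add: charts_at_iff)
    then show "(chart_map d \<circ> \<gamma>) differentiable (at t within {0..1})"
      using deriv[of t d] t
      by (meson IntD1 differentiableI_vector differentiable_at_withinI)
  next
    fix d assume d: "d \<in> A"
    let ?S = "{0..1} \<inter> \<gamma> -` chart_dom d"
    \<comment> \<open>The part of this condition used here is the continuity of the derivative of
      the coordinate change in the fixed direction \<open>q - p\<close>; it makes the velocity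
      continuous in the chart \<open>d\<close>.\<close>
    have "Ck_on (Suc 0) (chart_map c ` (chart_dom c \<inter> chart_dom d)) (chart_map d \<circ> chart_inv c)"
      using transition_smooth[OF c d] unfolding smooth_on_def by blast
    then have "continuous_on (chart_map c ` (chart_dom c \<inter> chart_dom d))
        (\<lambda>z. frechet_derivative (chart_map d \<circ> chart_inv c) (at z) (q - p))"
      by simp
    moreover have "l ` ?S \<subseteq> chart_map c ` (chart_dom c \<inter> chart_dom d)"
    proof
      fix z assume "z \<in> l ` ?S"
      then obtain t where t: "t \<in> {0..1}" "\<gamma> t \<in> chart_dom d" "z = l t" by blast
      then have "z = chart_map c (\<gamma> t)" "\<gamma> t \<in> chart_dom c"
        using map_\<gamma>[OF t(1)] at_\<gamma>[OF t(1)] by (simp_all add: charts_at_iff)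
      with t show "z \<in> chart_map c ` (chart_dom c \<inter> chart_dom d)" by blast
    qed
    ultimately have "continuous_on ?S (\<lambda>t. frechet_derivative (chart_map d \<circ> chart_inv c) (at (l t)) (q - p))"
      using continuous_on_compose2 l_cont by blast
    moreover have "vector_derivative (chart_map d \<circ> \<gamma>) (at t within {0..1}) =
        frechet_derivative (chart_map d \<circ> chart_inv c) (at (l t)) (q - p)" if t: "t \<in> ?S" for t
    proof -
      have "d \<in> charts_at A (\<gamma> t)" using d t by (simp add: charts_at_iff)
      then have "vector_derivative (chart_map d \<circ> \<gamma>) (at t within {0..1}) = transition_deriv c d (\<gamma> t) (q - p)"
        using deriv[of t d] t by (intro vector_derivative_at_within_ivl) auto
      then show ?thesis using map_\<gamma>[of t] t by (simp add: transition_deriv_def)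
    qed
    ultimately show "continuous_on ?S (\<lambda>t. vector_derivative (chart_map d \<circ> \<gamma>) (at t within {0..1}))"
      by (subst continuous_on_cong[OF refl])
  qed
  have "piecewise_C1_curve A \<gamma>"
    unfolding piecewise_C1_curve_def
  proof (intro conjI \<gamma>_cont exI[of _ "{0, 1::real}"] ballI impI)
    fix a b :: real assume "a \<in> {0, 1}" "b \<in> {0, 1}" "a < b \<and> {a<..<b} \<inter> {0, 1} = {}"
    then have "a = 0" "b = 1" by auto
    then show "C1_curve_on A a b \<gamma>" using C1 by simp
  qed simp_all
  then have "riem_dist A g (chart_inv c p) (chart_inv c q) \<le> curve_length A g \<gamma>"
    unfolding riem_dist_def by (intro INF_lower) (simp add: \<gamma>_def l_def)
  \<comment> \<open>A pointwise bound suffices: monotonicity of \<open>nn_integral\<close> requires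
    no measurability.\<close>
  also have "\<dots> \<le> (\<integral>\<^sup>+t. ennreal (M * norm (q - p)) * indicator {0..1::real} t \<partial>lborel)"
    unfolding curve_length_def
  proof (rule nn_integral_mono)
    fix t :: real
    show "ennreal (sqrt (g (\<gamma> t) (velocity A \<gamma> t) (velocity A \<gamma> t))) * indicator {0..1} t
        \<le> ennreal (M * norm (q - p)) * indicator {0..1} t"
    proof (cases "t \<in> {0..1}")
      case True
      have "velocity A \<gamma> t = coord_vec A c (\<gamma> t) (q - p)"
        using velocity_eq_coord_vec[OF isCont_\<gamma> at_\<gamma> deriv_c] True by blast
      then have "g (\<gamma> t) (velocity A \<gamma> t) (velocity A \<gamma> t) = local_metric c (l t) (q - p) (q - p)"
        by (simp add: local_metric_def \<gamma>_def)
      then show ?thesis using M(2)[OF lB[OF True]] True by (simp add: ennreal_leI)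
    qed simp
  qed
  also have "\<dots> = ennreal (M * norm (q - p))"
    by (simp add: nn_integral_cmult)
  finally show ?thesis .
qed

lemma eventually_riem_dist_less:
  assumes "\<delta> > 0"
  shows "eventually (\<lambda>y. riem_dist A g x y < ennreal \<delta>) (nhds x)"
proof -
  obtain c where c: "c \<in> charts_at A x" using charts_at_nonempty by blast
  then have cA: "c \<in> A" "x \<in> chart_dom c" by (simp_all add: charts_at_iff)
  define p where "p = chart_map c x"
  obtain r where r: "r > 0" "cball p r \<subseteq> chart_img c"
    using open_contains_cball open_chart_img[OF cA(1)] chart_map_in_img[OF cA(2)] p_def by metis
  obtain m M where M: "M > 0" "\<And>z a. z \<in> cball p r \<Longrightarrow> sqrt (local_metric c z a a) \<le> M * norm a"
    using local_metric_bounds[OF cA(1) compact_cball r(2)] by metis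
  have "filterlim (chart_map c) (nhds p) (nhds x)"
    using isCont_chart_map[OF cA] unfolding isCont_def tendsto_at_iff_tendsto_nhds p_def .
  \<comment> \<open>Radius \<open>r\<close> keeps the segment where \<open>M\<close> is valid, and
    radius \<open>\<delta> / M\<close> makes its length less than \<open>\<delta>\<close>.\<close>
  then have "eventually (\<lambda>y. chart_map c y \<in> ball p (min r (\<delta> / M))) (nhds x)"
    by (rule topological_tendstoD) (use r(1) M(1) assms in auto)
  moreover have "eventually (\<lambda>y. y \<in> chart_dom c) (nhds x)"
    using open_chart_dom cA eventually_nhds_in_open by blast
  ultimately show ?thesis
  proof eventually_elim
    case (elim y)
    have "riem_dist A g (chart_inv c p) (chart_inv c (chart_map c y)) \<le> ennreal (M * norm (chart_map c y - p))"
      using elim r M ball_subset_cball[of p r]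
      by (intro riem_dist_segment[OF cA(1), of "ball p r"]) (auto simp: subset_eq)
    also have "M * norm (chart_map c y - p) < \<delta>"
      using elim M(1) by (simp add: dist_norm norm_minus_commute field_simps)
    then have "ennreal (M * norm (chart_map c y - p)) < ennreal \<delta>"
      using M(1) by (subst ennreal_less_iff) auto
    finally show ?case
      using chart_inv_map[OF cA] chart_inv_map[OF cA(1) elim(2)] by (simp add: p_def)
  qed
qed

section \<open>Lower bounds for the distance by curves leaving a coordinate disc\<close>

lemma piecewise_C1_curve_interior:
  assumes "piecewise_C1_curve A \<gamma>"
  obtains K where "finite K"
    "\<And>c t. c \<in> A \<Longrightarrow> t \<in> {0<..<1} - K \<Longrightarrow> \<gamma> t \<in> chart_dom c \<Longrightarrow>
      (chart_map c \<circ> \<gamma>) differentiable (at t) \<and>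
      isCont (\<lambda>s. vector_derivative (chart_map c \<circ> \<gamma>) (at s)) t"
proof -
  obtain K where K: "finite K" "{0, 1} \<subseteq> K" "K \<subseteq> {0..1}"
    and C1: "\<forall>a\<in>K. \<forall>b\<in>K. a < b \<and> {a<..<b} \<inter> K = {} \<longrightarrow> C1_curve_on A a b \<gamma>"
    using assms unfolding piecewise_C1_curve_def by (elim conjE exE)
  show thesis
  proof (rule that[OF K(1)])
    fix c t assume c: "c \<in> A" and t: "t \<in> {0<..<1} - K" and dom: "\<gamma> t \<in> chart_dom c"
    \<comment> \<open>the break points adjacent to \<open>t\<close>\<close>
    define a where "a = Max {k\<in>K. k < t}"
    define b where "b = Min {k\<in>K. t < k}"
    have "0 \<in> {k\<in>K. k < t}" "1 \<in> {k\<in>K. t < k}" using t K by auto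
    then have a: "a \<in> {k\<in>K. k < t}" and b: "b \<in> {k\<in>K. t < k}"
      unfolding a_def b_def using K(1) by (intro Max_in Min_in; force)+
    have "{a<..<b} \<inter> K = {}"
    proof (intro equals0I)
      fix k assume k: "k \<in> {a<..<b} \<inter> K"
      have "k \<noteq> t" using k t by auto
      then consider "k \<in> {k\<in>K. k < t}" | "k \<in> {k\<in>K. t < k}" using k by fastforce
      then show False
      proof cases
        case 1 then have "k \<le> a" unfolding a_def using K(1) by (intro Max_ge) auto
        with k show False by simp
      next
        case 2 then have "b \<le> k" unfolding b_def using K(1) by (intro Min_le) auto
        with k show False by simp
      qed
    qed
    then have C: "C1_curve_on A a b \<gamma>" using a b C1 by simp
    \<comment> \<open>Strictly between adjacent break points the one-sided derivatives of
      \<open>C1_curve_on\<close> become ordinary ones.\<close>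
    have at: "at s within {a..b} = at s" if "s \<in> {a<..<b}" for s
      using that by (intro at_within_Icc_at) auto
    have tab: "t \<in> {a<..<b}" using a b by simp
    define N where "N = {a<..<b} \<inter> \<gamma> -` chart_dom c"
    have \<gamma>: "continuous_on {a..b} \<gamma>" using C unfolding C1_curve_on_def by blast
    have "open N"
      unfolding N_def using \<gamma> open_chart_dom[OF c]
      by (intro continuous_open_preimage continuous_on_subset[OF \<gamma>]) auto
    have tN: "t \<in> N" using tab dom by (simp add: N_def)
    have d: "\<forall>s\<in>{a..b} \<inter> \<gamma> -` chart_dom c. (chart_map c \<circ> \<gamma>) differentiable (at s within {a..b})"
      and dc: "continuous_on ({a..b} \<inter> \<gamma> -` chart_dom c)
          (\<lambda>s. vector_derivative (chart_map c \<circ> \<gamma>) (at s within {a..b}))"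
      using C c unfolding C1_curve_on_def by blast+
    have "(chart_map c \<circ> \<gamma>) differentiable (at t within {a..b})"
      using d tab dom by auto
    moreover have "continuous_on N (\<lambda>s. vector_derivative (chart_map c \<circ> \<gamma>) (at s within {a..b}))"
      by (rule continuous_on_subset[OF dc]) (auto simp: N_def)
    then have "continuous_on N (\<lambda>s. vector_derivative (chart_map c \<circ> \<gamma>) (at s))"
      by (rule continuous_on_eq) (simp add: N_def at)
    ultimately show "(chart_map c \<circ> \<gamma>) differentiable (at t) \<and>
        isCont (\<lambda>s. vector_derivative (chart_map c \<circ> \<gamma>) (at s)) t"
      using at[OF tab] \<open>open N\<close> tN continuous_on_eq_continuous_at by auto
  qed
qed

text \<open>The integrand of \<open>curve_length\<close> is not known to be measurable. It is therefore bounded from below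
  by the Borel function \<open>\<psi>\<close>, built from the component of the velocity in the direction \<open>u\<close> of the
  displacement; the fundamental theorem of calculus applies to that component.\<close>

lemma curve_length_ge:
  assumes \<gamma>: "piecewise_C1_curve A \<gamma>" and c: "c \<in> A" and s: "0 \<le> s" "s \<le> 1"
    and dom: "\<And>t. t \<in> {0..s} \<Longrightarrow> \<gamma> t \<in> chart_dom c"
    and m: "m \<ge> 0" "\<And>t a. t \<in> {0..s} \<Longrightarrow> m * norm a \<le> sqrt (local_metric c (chart_map c (\<gamma> t)) a a)"
  shows "ennreal (m * norm (chart_map c (\<gamma> s) - chart_map c (\<gamma> 0))) \<le> curve_length A g \<gamma>"
proof (cases "curve_length A g \<gamma> = \<infinity>")
  case False
  define h where "h = chart_map c \<circ> \<gamma>"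
  define w where "w = (\<lambda>t. vector_derivative h (at t))"
  define u where "u = sgn (h s - h 0)"
  obtain K where K: "finite K"
    and diff: "\<And>t. t \<in> {0<..<1} - K \<Longrightarrow> \<gamma> t \<in> chart_dom c \<Longrightarrow> h differentiable (at t) \<and> isCont w t"
    using piecewise_C1_curve_interior[OF \<gamma>] c unfolding h_def w_def by metis
  \<comment> \<open>On this open set the velocity exists and is continuous, so cutting off by its
    indicator gives a Borel function; the finite set \<open>K\<close> is harmless in the fundamental
    theorem of calculus.\<close>
  define G where "G = {0<..<s} - K"
  have G: "open G" "G \<subseteq> {0..s}" "G \<subseteq> {0<..<1} - K"
    using K s by (auto simp: G_def intro!: open_Diff finite_imp_closed)
  have w: "(h has_vector_derivative w t) (at t)" "isCont w t" if "t \<in> G" for t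
  proof -
    have "t \<in> {0<..<1} - K" "\<gamma> t \<in> chart_dom c" using that G dom by auto
    from diff[OF this] show "(h has_vector_derivative w t) (at t)" "isCont w t"
      by (auto simp: w_def vector_derivative_works)
  qed
  have \<gamma>_cont: "continuous_on {0..1} \<gamma>"
    using \<gamma> unfolding piecewise_C1_curve_def by blast
  have \<gamma>_isCont: "isCont \<gamma> t" if "t \<in> G" for t
  proof -
    have "t \<in> {0<..<1}" using that s by (auto simp: G_def)
    moreover have "continuous_on {0<..<1} \<gamma>" by (rule continuous_on_subset[OF \<gamma>_cont]) auto
    ultimately show ?thesis using continuous_on_eq_continuous_at by (metis open_greaterThanLessThan)
  qed
  have h_cont: "continuous_on {0..s} h"
    unfolding h_def using s dom
    by (intro continuous_on_compose continuous_on_subset[OF \<gamma>_cont]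
        continuous_on_subset[OF continuous_chart_map[OF c]]) auto
  define \<phi> where "\<phi> = (\<lambda>t. indicator G t *\<^sub>R (w t \<bullet> u))"
  \<comment> \<open>The positive part is taken to have a nonnegative integrand for
    \<open>nn_integral\<close>; it can only increase the integral of
    \<open>m * \<phi>\<close>.\<close>
  define \<psi> where "\<psi> = (\<lambda>t. m * max 0 (\<phi> t))"
  have "(\<phi> has_integral (h s \<bullet> u - h 0 \<bullet> u)) {0..s}"
  proof (rule fundamental_theorem_of_calculus_interior_strong[OF K s(1)])
    fix t assume "t \<in> {0<..<s} - K"
    then have t: "t \<in> G" by (simp add: G_def)
    have "((\<lambda>t. h t \<bullet> u) has_derivative (\<lambda>r. (r *\<^sub>R w t) \<bullet> u)) (at t)"
      using w(1)[OF t] unfolding has_vector_derivative_def by (rule has_derivative_inner_left)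
    then show "((\<lambda>t. h t \<bullet> u) has_vector_derivative \<phi> t) (at t)"
      using t by (simp add: \<phi>_def has_vector_derivative_def)
  qed (intro continuous_intros h_cont)
  \<comment> \<open>If there is no displacement, then \<open>u = 0\<close> and both sides
    vanish.\<close>
  moreover have "(h s - h 0) \<bullet> u = norm (h s - h 0)"
    unfolding u_def sgn_div_norm inner_scaleR_right dot_square_norm
    by (cases "h s = h 0") (simp_all add: power2_eq_square)
  then have "h s \<bullet> u - h 0 \<bullet> u = norm (h s - h 0)" by (simp only: inner_diff_left)
  ultimately have "(\<phi> has_integral norm (h s - h 0)) {0..s}" by simp
  then have "(\<phi> has_integral norm (h s - h 0)) UNIV"
    by (rule has_integral_on_superset) (use G in \<open>auto simp: \<phi>_def indicator_def\<close>)
  then have \<phi>: "((\<lambda>t. m * \<phi> t) has_integral m * norm (h s - h 0)) UNIV"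
    by (rule has_integral_mult_right)
  have "continuous_on G (\<lambda>t. w t \<bullet> u)"
    using w(2) by (intro continuous_intros) (simp add: continuous_at_imp_continuous_on)
  then have "\<phi> \<in> borel_measurable borel"
    unfolding \<phi>_def using G(1) by (intro borel_measurable_continuous_on_indicator) auto
  then have \<psi>_meas: "\<psi> \<in> borel_measurable borel"
    unfolding \<psi>_def by measurable
  have \<psi>_le: "(\<integral>\<^sup>+t. \<psi> t \<partial>lborel) \<le> curve_length A g \<gamma>"
    unfolding curve_length_def
  proof (rule nn_integral_mono)
    fix t :: real
    show "ennreal (\<psi> t) \<le> ennreal (sqrt (g (\<gamma> t) (velocity A \<gamma> t) (velocity A \<gamma> t))) * indicator {0..1} t"
    proof (cases "t \<in> G")
      case True
      then have t: "t \<in> {0..s}" "t \<in> {0..1}" using G s by auto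
      have at: "c \<in> charts_at A (\<gamma> t)" using c dom[OF t(1)] by (simp add: charts_at_iff)
      have "velocity A \<gamma> t = coord_vec A c (\<gamma> t) (w t)"
        using velocity_eq_coord_vec[OF \<gamma>_isCont[OF True] at] w(1)[OF True] by (simp add: h_def)
      then have "g (\<gamma> t) (velocity A \<gamma> t) (velocity A \<gamma> t) = local_metric c (chart_map c (\<gamma> t)) (w t) (w t)"
        using chart_inv_map[OF c dom[OF t(1)]] by (simp add: local_metric_def)
      moreover have "\<psi> t \<le> m * norm (w t)"
      proof -
        have "w t \<bullet> u \<le> norm (w t) * norm u" by (rule norm_cauchy_schwarz)
        also have "\<dots> \<le> norm (w t) * 1" by (intro mult_left_mono) (simp_all add: u_def norm_sgn)
        finally show ?thesis using m(1) True by (simp add: \<psi>_def \<phi>_def mult_left_mono)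
      qed
      ultimately show ?thesis using m(2)[OF t(1), of "w t"] t(2) by (simp add: ennreal_leI)
    qed (simp add: \<psi>_def \<phi>_def)
  qed
  \<comment> \<open>Finite length makes the integral of \<open>\<psi>\<close> a real number, so it
    is also a gauge integral and can be compared with that of \<open>m * \<phi>\<close>.\<close>
  then obtain r where r: "r \<ge> 0" "(\<integral>\<^sup>+t. \<psi> t \<partial>lborel) = ennreal r"
    using False by (metis ennreal_cases infinity_ennreal_def neq_top_trans)
  have "m * norm (h s - h 0) \<le> r"
  proof (rule has_integral_le[OF \<phi>])
    show "(\<psi> has_integral r) UNIV"
      using \<psi>_meas r m(1) by (intro nn_integral_has_integral) (auto simp: \<psi>_def)
  qed (use m(1) in \<open>simp add: \<psi>_def mult_left_mono\<close>)
  then have "ennreal (m * norm (h s - h 0)) \<le> ennreal r" by (rule ennreal_leI)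
  with \<psi>_le show ?thesis unfolding r(2) by (simp add: h_def)
qed simp

text \<open>A curve from \<open>x\<close> to a point outside \<open>U\<close> must leave a
  coordinate disc of radius \<open>r\<close> around \<open>x\<close>. It then has length at least
  \<open>m * r\<close>, with \<open>m\<close> the lower metric bound on the closed disc; hence the
  choice of \<open>\<delta>\<close>.\<close>

lemma riem_dist_small:
  assumes U: "open U" "x \<in> U"
  obtains \<delta> where "\<delta> > 0" "\<And>y. riem_dist A g x y < ennreal \<delta> \<Longrightarrow> y \<in> U"
proof -
  obtain c where c: "c \<in> charts_at A x" using charts_at_nonempty by blast
  then have cA: "c \<in> A" "x \<in> chart_dom c" by (simp_all add: charts_at_iff)
  define p where "p = chart_map c x"
  obtain r0 where r0: "r0 > 0" "\<And>q. dist q p < r0 \<Longrightarrow> q \<in> chart_img c \<and> chart_inv c q \<in> U"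
    using eventually_chart_inv[OF c U] unfolding eventually_nhds_metric p_def by blast
  \<comment> \<open>Halving puts the closed disc inside the open one.\<close>
  define r where "r = r0 / 2"
  have r: "r > 0" "cball p r \<subseteq> chart_img c" "chart_inv c ` cball p r \<subseteq> U"
    using r0 by (auto simp: r_def dist_commute)
  obtain m M where m: "m > 0" "\<And>z a. z \<in> cball p r \<Longrightarrow> m * norm a \<le> sqrt (local_metric c z a a)"
    using local_metric_bounds[OF cA(1) compact_cball r(2)] by metis
  define V where "V = chart_dom c \<inter> chart_map c -` ball p r"
  have V: "open V"
    unfolding V_def using continuous_chart_map open_chart_dom cA by (intro continuous_open_preimage) auto
  have "compact (chart_inv c ` cball p r)"
    using continuous_on_subset[OF continuous_chart_inv[OF cA(1)] r(2)] by (intro compact_continuous_image) auto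
  then have C: "closed (chart_inv c ` cball p r)" by (rule compact_imp_closed)
  have VC: "V \<subseteq> chart_inv c ` cball p r"
  proof
    fix y assume "y \<in> V"
    then have "y = chart_inv c (chart_map c y)" "chart_map c y \<in> cball p r"
      using chart_inv_map[OF cA(1)] by (auto simp: V_def)
    then show "y \<in> chart_inv c ` cball p r" by blast
  qed
  have xV: "x \<in> V" using cA r(1) by (simp add: V_def p_def)
  show thesis
  proof (rule that)
    show "m * r > 0" using m r by simp
    fix y assume y: "riem_dist A g x y < ennreal (m * r)"
    show "y \<in> U"
    proof (rule ccontr)
      assume yU: "y \<notin> U"
      obtain \<gamma> where \<gamma>: "piecewise_C1_curve A \<gamma>" "\<gamma> 0 = x" "\<gamma> 1 = y" "curve_length A g \<gamma> < ennreal (m * r)"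
        using y unfolding riem_dist_def INF_less_iff by blast
      have \<gamma>_cont: "continuous_on {0..1} \<gamma>"
        using \<gamma>(1) unfolding piecewise_C1_curve_def by blast
      \<comment> \<open>up to the first exit time \<open>s\<close> the curve stays in the chart and covers the distance \<open>r\<close>\<close>
      define T where "T = {0..1} \<inter> \<gamma> -` (- V)"
      define s where "s = Inf T"
      have T: "closed T"
        unfolding T_def using \<gamma>_cont V by (intro continuous_closed_preimage) auto
      have "1 \<in> T" using \<gamma>(3) yU VC r(3) by (auto simp: T_def)
      have bdd: "bdd_below T" by (auto simp: T_def intro: bdd_belowI[of _ 0])
      have sT: "s \<in> T"
        unfolding s_def using \<open>1 \<in> T\<close> T bdd by (intro closed_contains_Inf) auto
      have s: "0 \<le> s" "s \<le> 1" "\<gamma> s \<notin> V" using sT by (auto simp: T_def)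
      have "s \<noteq> 0" using s(3) \<gamma>(2) xV by metis
      have before: "\<gamma> t \<in> V" if "t \<in> {0..<s}" for t
      proof (rule ccontr)
        assume "\<gamma> t \<notin> V"
        then have "t \<in> T" using that s by (simp add: T_def)
        then have "s \<le> t" unfolding s_def using bdd by (rule cInf_lower)
        then show False using that by simp
      qed
      \<comment> \<open>Before time \<open>s\<close> the curve is in \<open>V\<close>; closedness of
        the disc's image extends the containment to time \<open>s\<close>. So
        \<open>\<gamma> s\<close> still lies in the chart, and not being in \<open>V\<close> it has
        coordinate distance at least \<open>r\<close> from \<open>p\<close>.\<close>
      have "\<gamma> ` closure {0..<s} \<subseteq> chart_inv c ` cball p r"
        using \<gamma>_cont s \<open>s \<noteq> 0\<close> before VC
        by (intro image_closure_subset[OF _ C]) (auto intro: continuous_on_subset)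
      then have \<gamma>C: "\<gamma> t \<in> chart_inv c ` cball p r" if "t \<in> {0..s}" for t
        using that s \<open>s \<noteq> 0\<close> by auto
      have in_dom: "\<gamma> t \<in> chart_dom c" and in_ball: "chart_map c (\<gamma> t) \<in> cball p r" if t: "t \<in> {0..s}" for t
      proof -
        obtain q where q: "\<gamma> t = chart_inv c q" "q \<in> cball p r" using \<gamma>C[OF t] by blast
        then show "\<gamma> t \<in> chart_dom c" "chart_map c (\<gamma> t) \<in> cball p r"
          using r(2) chart_inv_in_dom[OF cA(1)] chart_map_inv[OF cA(1)] by auto
      qed
      have "ennreal (m * norm (chart_map c (\<gamma> s) - chart_map c (\<gamma> 0))) \<le> curve_length A g \<gamma>"
        using curve_length_ge[OF \<gamma>(1) cA(1) s(1,2) in_dom] m in_ball by auto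
      moreover have "r \<le> norm (chart_map c (\<gamma> s) - chart_map c (\<gamma> 0))"
        using s(3) in_dom[of s] s(1) by (auto simp: V_def \<gamma>(2) p_def dist_norm norm_minus_commute)
      then have "ennreal (m * r) \<le> ennreal (m * norm (chart_map c (\<gamma> s) - chart_map c (\<gamma> 0)))"
        using m(1) by (intro ennreal_leI mult_left_mono) auto
      ultimately show False using \<gamma>(4) by order
    qed
  qed
qed

text \<open>Only the finitely many times \<open>j \<le> n\<close> impose conditions, and each holds
  near \<open>x\<close> by continuity of the iterate.\<close>

lemma eventually_dyn_ball:
  assumes f: "continuous_on UNIV f" and "\<delta> > 0"
  shows "eventually (\<lambda>y. y \<in> dyn_ball A g f x \<delta> n) (nhds x)"
proof -
  have "eventually (\<lambda>y. riem_dist A g ((f ^^ j) x) ((f ^^ j) y) < ennreal \<delta>) (nhds x)" for j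
  proof -
    have "continuous_on UNIV (f ^^ j)"
    proof (induction j)
      case (Suc j)
      then show ?case using continuous_on_compose[OF Suc continuous_on_subset[OF f]] by simp
    qed simp
    then have "isCont (f ^^ j) x" by (simp add: continuous_on_eq_continuous_at)
    then have "filterlim (f ^^ j) (nhds ((f ^^ j) x)) (nhds x)"
      unfolding isCont_def tendsto_at_iff_tendsto_nhds .
    then show ?thesis
      using eventually_riem_dist_less[OF \<open>\<delta> > 0\<close>, of "(f ^^ j) x"] unfolding filterlim_iff by blast
  qed
  then have "eventually (\<lambda>y. \<forall>j\<in>{..n}. riem_dist A g ((f ^^ j) x) ((f ^^ j) y) < ennreal \<delta>) (nhds x)"
    by (intro eventually_ball_finite) auto
  then show ?thesis by (simp add: dyn_ball_def atMost_def)
qed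

end


section \<open>Lyapunov exponents\<close>

lemma eln_less_ereal_iff: "eln a < ereal z \<longleftrightarrow> a < ennreal (exp z)"
proof (cases a)
  case (real r)
  have "r < exp z \<longleftrightarrow> ln r < z" if "r > 0"
    using that by (metis exp_less_cancel_iff exp_ln)
  then show ?thesis using real by (cases "r = 0") (auto simp: eln_def ennreal_less_iff)
qed (simp add: eln_def)

lemma ereal_less_eln_iff: "ereal z < eln a \<longleftrightarrow> ennreal (exp z) < a"
proof (cases a)
  case (real r)
  have "exp z < r \<longleftrightarrow> z < ln r" if "r > 0"
    using that by (metis exp_less_cancel_iff exp_ln)
  then show ?thesis using real by (cases "r = 0") (auto simp: eln_def ennreal_less_iff)
qed (simp add: eln_def)

text \<open>In the order topology of \<open>ereal\<close> it is enough to test real thresholds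
  \<open>z\<close>, by density. There \<open>eln\<close> can be exchanged for \<open>exp\<close>,
  uniformly including the values 0 and \<infinity>.\<close>

lemma tendsto_eln:
  assumes "(h \<longlongrightarrow> L) F"
  shows "((\<lambda>x. eln (h x)) \<longlongrightarrow> eln L) F"
proof (rule order_tendstoI)
  fix y assume "y < eln L"
  then obtain z where z: "y < ereal z" "ereal z < eln L" using ereal_dense2 by blast
  then have "ennreal (exp z) < L" by (simp add: ereal_less_eln_iff)
  then have "eventually (\<lambda>x. ennreal (exp z) < h x) F" using assms order_tendstoD(1) by blast
  then show "eventually (\<lambda>x. y < eln (h x)) F"
    by eventually_elim (use z in \<open>simp add: ereal_less_eln_iff[symmetric]\<close>)
next
  fix y assume "eln L < y"
  then obtain z where z: "eln L < ereal z" "ereal z < y" using ereal_dense2 by blast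
  then have "L < ennreal (exp z)" by (simp add: eln_less_ereal_iff)
  then have "eventually (\<lambda>x. h x < ennreal (exp z)) F" using assms order_tendstoD(2) by blast
  then show "eventually (\<lambda>x. eln (h x) < y) F"
    by eventually_elim (use z in \<open>simp add: eln_less_ereal_iff[symmetric]\<close>)
qed

text \<open>For \<open>a = 0\<close> both sides are -\<infinity>, because the added term is
  finite.\<close>

lemma eln_divide:
  assumes "a \<ge> 0" "b > 0"
  shows "eln (ennreal (a / b)) = eln (ennreal a) + ereal (- ln b)"
proof (cases "a = 0")
  case False
  then have "eln (ennreal (a / b)) = ereal (ln (a / b))" "eln (ennreal a) = ereal (ln a)"
    using assms by (simp_all add: eln_def ennreal_eq_0_iff divide_le_0_iff)
  then show ?thesis using False assms by (simp add: ln_div)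
qed (simp add: eln_def)

text \<open>Taking \<open>e\<close> as half the gap to a finite threshold turns the weak bounds into
  strict ones. A negative \<open>L - e\<close> is truncated to 0 by \<open>ennreal\<close> and then
  gives a trivial lower bound.\<close>

lemma tendsto_ennreal_sandwich:
  assumes "\<And>e. e > 0 \<Longrightarrow> eventually (\<lambda>x. ennreal (L - e) \<le> h x \<and> h x \<le> ennreal (L + e)) F"
    and "L \<ge> 0"
  shows "(h \<longlongrightarrow> ennreal L) F"
proof (rule order_tendstoI)
  fix a assume a: "a < ennreal L"
  then obtain b where b: "b \<ge> 0" "a = ennreal b" by (cases a) auto
  with a have "b < L" by (simp add: ennreal_less_iff)
  have "eventually (\<lambda>x. ennreal (L - (L - b) / 2) \<le> h x \<and> h x \<le> ennreal (L + (L - b) / 2)) F"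
    using \<open>b < L\<close> by (intro assms) simp
  moreover have "a < ennreal (L - (L - b) / 2)"
    using b \<open>b < L\<close> by (simp add: ennreal_less_iff field_simps)
  ultimately show "eventually (\<lambda>x. a < h x) F"
    by (auto elim!: eventually_mono)
next
  fix a assume a: "ennreal L < a"
  obtain e where e: "e > 0" "ennreal (L + e) < a"
  proof (cases a)
    case (real b)
    with a assms(2) have "L < b" by (simp add: ennreal_less_iff)
    then have "ennreal (L + (b - L) / 2) < a"
      using real assms(2) by (simp add: ennreal_less_iff field_simps)
    then show thesis using that[of "(b - L) / 2"] \<open>L < b\<close> by simp
  qed (use that[of 1] in simp)
  from assms(1)[OF e(1)] show "eventually (\<lambda>x. h x < a) F"
    by eventually_elim (use e(2) in auto)
qed

lemma first_chart:
  assumes "\<And>i. i \<in> {1..k} \<Longrightarrow> \<phi> i \<in> A" "(\<Union>i\<in>{1..k}. chart_dom (\<phi> i)) = UNIV"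
  shows "first_chart k \<phi> x \<in> charts_at A x"
proof -
  have "x \<in> (\<Union>i\<in>{1..k}. chart_dom (\<phi> i))" using assms(2) by simp
  then obtain i where "i \<in> {1..k} \<and> x \<in> chart_dom (\<phi> i)" by blast
  then have "(LEAST i. i \<in> {1..k} \<and> x \<in> chart_dom (\<phi> i)) \<in> {1..k} \<and>
      x \<in> chart_dom (\<phi> (LEAST i. i \<in> {1..k} \<and> x \<in> chart_dom (\<phi> i)))"
    by (rule LeastI)
  then show ?thesis using assms(1) by (simp add: first_chart_def charts_at_def)
qed

section \<open>Limits of difference quotients and equality of the exponents\<close>

context riemannian_surface
begin

text \<open>For small \<open>\<delta>\<close> all quotients in the supremum are within
  \<open>e\<close> of the limit, uniformly in \<open>y\<close>. This bounds the supremum above, and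
  below as soon as one such \<open>y\<close> exists.\<close>

lemma SUP_diff_quot_tendsto:
  fixes \<phi> :: "nat \<Rightarrow> 'a chart" and f :: "'a \<Rightarrow> 'a" and k n :: nat and x :: 'a
  defines "c \<equiv> first_chart k \<phi> x" and "d \<equiv> first_chart k \<phi> ((f ^^ n) x)"
  assumes f: "continuous_on UNIV f" and c: "c \<in> charts_at A x" and w: "v c \<noteq> 0"
    and D: "(chart_map d \<circ> (f ^^ n) \<circ> chart_inv c has_derivative D) (at (chart_map c x))"
  shows "((\<lambda>\<delta>. SUP y\<in>(dyn_ball A g f x \<delta> n - {x}) \<inter> tangent_line k \<phi> x v. ennreal (diff_quot k \<phi> f n x y))
    \<longlongrightarrow> ennreal (norm (D (v c)) / norm (v c))) (at_right 0)"
proof (rule tendsto_ennreal_sandwich)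
  define F where "F = chart_map d \<circ> (f ^^ n) \<circ> chart_inv c"
  define p where "p = chart_map c x"
  define L where "L = norm (D (v c)) / norm (v c)"
  have cA: "c \<in> A" "x \<in> chart_dom c" using c by (simp_all add: charts_at_iff)
  have line: "tangent_line k \<phi> x v = {y \<in> chart_dom c. \<exists>s. chart_map c y = p + s *\<^sub>R v c}"
    by (simp add: tangent_line_def c_def p_def Let_def)
  have quot: "diff_quot k \<phi> f n x y = norm (F p - F (chart_map c y)) / norm (p - chart_map c y)"
    if "y \<in> chart_dom c" for y
    using chart_inv_map[OF cA] chart_inv_map[OF cA(1) that]
    by (simp add: diff_quot_def Let_def c_def[symmetric] d_def[symmetric] F_def p_def)
  fix e :: real assume e: "e > 0"
  obtain \<eta> where \<eta>: "\<eta> > 0"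
    "\<And>z. norm (z - p) < \<eta> \<Longrightarrow> norm (F z - F p - D (z - p)) \<le> e * norm (z - p)"
    using D e unfolding has_derivative_at_alt F_def[symmetric] p_def[symmetric] by blast
  define U where "U = chart_dom c \<inter> chart_map c -` ball p \<eta>"
  have "open U"
    unfolding U_def using continuous_chart_map open_chart_dom cA by (intro continuous_open_preimage) auto
  moreover have "x \<in> U" using cA \<eta>(1) by (simp add: U_def p_def)
  ultimately obtain \<delta>0 where \<delta>0: "\<delta>0 > 0" "\<And>y. riem_dist A g x y < ennreal \<delta>0 \<Longrightarrow> y \<in> U"
    using riem_dist_small by blast
  have near: "\<bar>diff_quot k \<phi> f n x y - L\<bar> \<le> e"
    if \<delta>: "\<delta> < \<delta>0" and y: "y \<in> (dyn_ball A g f x \<delta> n - {x}) \<inter> tangent_line k \<phi> x v" for \<delta> y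
  proof -
    obtain s where s: "chart_map c y = p + s *\<^sub>R v c" and y_dom: "y \<in> chart_dom c"
      using y by (auto simp: line)
    have "s \<noteq> 0"
    proof
      assume "s = 0"
      then have "chart_inv c (chart_map c y) = chart_inv c (chart_map c x)" using s by (simp add: p_def)
      then show False using y chart_inv_map[OF cA] chart_inv_map[OF cA(1) y_dom] by simp
    qed
    \<comment> \<open>Time \<open>j = 0\<close> of the dynamical ball says that \<open>y\<close>
      itself is close to \<open>x\<close>.\<close>
    have "riem_dist A g ((f ^^ 0) x) ((f ^^ 0) y) < ennreal \<delta>"
      using y unfolding dyn_ball_def by blast
    also have "\<dots> \<le> ennreal \<delta>0" using \<delta> by (simp add: ennreal_leI)
    finally have "y \<in> U" using \<delta>0(2) by simp
    then have "norm (chart_map c y - p) < \<eta>" by (simp add: U_def dist_norm norm_minus_commute)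
    then have *: "norm (F (chart_map c y) - F p - s *\<^sub>R D (v c)) \<le> e * norm (s *\<^sub>R v c)"
      using \<eta>(2)[of "chart_map c y"] linear_cmul[OF has_derivative_linear[OF D]] by (simp add: s)
    have "\<bar>norm (F (chart_map c y) - F p) - norm (s *\<^sub>R D (v c))\<bar> \<le> e * norm (s *\<^sub>R v c)"
      using order_trans[OF norm_triangle_ineq3 *] .
    moreover have "norm (s *\<^sub>R v c) > 0" using \<open>s \<noteq> 0\<close> w by simp
    \<comment> \<open>The factor \<open>s\<close> cancels, so \<open>L\<close> is the quotient of
      the linear part at every point of the line, on both sides of \<open>x\<close>.\<close>
    moreover have "L = norm (s *\<^sub>R D (v c)) / norm (s *\<^sub>R v c)" using \<open>s \<noteq> 0\<close> by (simp add: L_def)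
    moreover have "diff_quot k \<phi> f n x y = norm (F (chart_map c y) - F p) / norm (s *\<^sub>R v c)"
      using quot[OF y_dom] s by (simp add: norm_minus_commute)
    ultimately show ?thesis
      by (simp only: diff_divide_distrib[symmetric] abs_divide abs_norm_cancel pos_divide_le_eq)
  qed
  \<comment> \<open>This needs \<open>v c \<noteq> 0\<close>; over an empty set the supremum would
    be 0 and the lower bound could fail.\<close>
  have nonempty: "\<exists>y. y \<in> (dyn_ball A g f x \<delta> n - {x}) \<inter> tangent_line k \<phi> x v" if \<delta>: "\<delta> > 0" for \<delta>
  proof -
    obtain W where W: "open W" "x \<in> W" "\<And>y. y \<in> W \<Longrightarrow> y \<in> dyn_ball A g f x \<delta> n"
      using eventually_dyn_ball[OF f \<delta>, of x n] unfolding eventually_nhds by blast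
    obtain r where r: "r > 0" "\<And>q. dist q p < r \<Longrightarrow> q \<in> chart_img c \<and> chart_inv c q \<in> W"
      using eventually_chart_inv[OF c W(1,2)] unfolding eventually_nhds_metric p_def by blast
    \<comment> \<open>The coefficient places \<open>q\<close> on the line at distance
      \<open>r / 2\<close> from \<open>p\<close>.\<close>
    define q where "q = p + (r / (2 * norm (v c))) *\<^sub>R v c"
    have "dist q p < r" using r(1) w by (simp add: q_def dist_norm)
    note q = r(2)[OF this]
    have map_q: "chart_map c (chart_inv c q) = q" using q chart_map_inv[OF cA(1)] by blast
    have "q \<noteq> p" using r(1) w by (simp add: q_def)
    then have "chart_inv c q \<noteq> x" using map_q p_def by metis
    moreover have "chart_inv c q \<in> tangent_line k \<phi> x v"
      using map_q q chart_inv_in_dom[OF cA(1)] by (auto simp: line q_def)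
    ultimately show ?thesis using q W(3) by blast
  qed
  \<comment> \<open>Positivity of \<open>\<delta>\<close> serves \<open>nonempty\<close>, the upper
    bound serves \<open>near\<close>.\<close>
  have "eventually (\<lambda>\<delta>. \<delta> \<in> {0<..<\<delta>0}) (at_right (0::real))"
    using \<delta>0(1) eventually_at_right_real by blast
  then show "\<forall>\<^sub>F \<delta> in at_right 0. ennreal (norm (D (v c)) / norm (v c) - e)
      \<le> (SUP y\<in>(dyn_ball A g f x \<delta> n - {x}) \<inter> tangent_line k \<phi> x v. ennreal (diff_quot k \<phi> f n x y))
    \<and> (SUP y\<in>(dyn_ball A g f x \<delta> n - {x}) \<inter> tangent_line k \<phi> x v. ennreal (diff_quot k \<phi> f n x y))
      \<le> ennreal (norm (D (v c)) / norm (v c) + e)"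
    unfolding L_def[symmetric]
  proof eventually_elim
    case (elim \<delta>)
    obtain y where y: "y \<in> (dyn_ball A g f x \<delta> n - {x}) \<inter> tangent_line k \<phi> x v"
      using nonempty elim by auto
    have "ennreal (L - e) \<le> ennreal (diff_quot k \<phi> f n x y)"
      using near[OF _ y] elim by (intro ennreal_leI) auto
    moreover have "ennreal (diff_quot k \<phi> f n x z) \<le> ennreal (L + e)"
      if "z \<in> (dyn_ball A g f x \<delta> n - {x}) \<inter> tangent_line k \<phi> x v" for z
      using near[OF _ that] elim by (intro ennreal_leI) auto
    ultimately show ?case using y by (auto intro: SUP_upper2 SUP_least)
  qed
qed simp

theorem new_lyapunov_eq_usual:
  assumes \<phi>: "\<And>i. i \<in> {1..k} \<Longrightarrow> \<phi> i \<in> A" "(\<Union>i\<in>{1..k}. chart_dom (\<phi> i)) = UNIV"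
    and f: "differentiable_map A f" and v: "v \<in> tangent_space A x"
  shows "new_lyapunov A g k \<phi> f x v = usual_lyapunov A k \<phi> f x v"
proof -
  define c where "c = first_chart k \<phi> x"
  have c: "c \<in> charts_at A x" unfolding c_def using \<phi> by (rule first_chart)
  define T where "T = (\<lambda>n. tnorm k \<phi> ((f ^^ n) x) (tangent_map A (f ^^ n) x v))"
  define Q where "Q = (\<lambda>n \<delta>. SUP y\<in>(dyn_ball A g f x \<delta> n - {x}) \<inter> tangent_line k \<phi> x v.
      ennreal (diff_quot k \<phi> f n x y))"
  have new: "new_lyapunov A g k \<phi> f x v = limsup (\<lambda>n. Lim (at_right 0) (\<lambda>\<delta>. ereal (1 / real n) * eln (Q n \<delta>)))"
    by (simp add: new_lyapunov_def Q_def)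
  have usual: "usual_lyapunov A k \<phi> f x v = limsup (\<lambda>n. ereal (1 / real n) * eln (ennreal (T n)))"
    by (simp add: usual_lyapunov_def T_def)
  have deriv: "\<exists>D. (chart_map (first_chart k \<phi> ((f ^^ n) x)) \<circ> (f ^^ n) \<circ> chart_inv c has_derivative D)
      (at (chart_map c x)) \<and> T n = norm (D (v c))" for n
  proof -
    have d: "first_chart k \<phi> ((f ^^ n) x) \<in> charts_at A ((f ^^ n) x)" using \<phi> by (rule first_chart)
    obtain D where D: "(chart_map (first_chart k \<phi> ((f ^^ n) x)) \<circ> (f ^^ n) \<circ> chart_inv c has_derivative D)
      (at (chart_map c x))"
      using differentiable_mapD[OF differentiable_map_funpow[OF f] c d] .
    then show ?thesis
      using tangent_map_chart[OF differentiable_map_funpow[OF f] v c d D] by (auto simp: T_def tnorm_def)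
  qed
  show ?thesis
  proof (cases "v c = 0")
    case True
    \<comment> \<open>The line degenerates to a point, so every supremum is over the empty set and
      equals 0. As \<open>T n\<close> vanishes too, the two sequences agree term by term.\<close>
    have "tangent_line k \<phi> x v \<subseteq> {x}"
    proof
      fix y assume "y \<in> tangent_line k \<phi> x v"
      then have "y \<in> chart_dom c" "chart_map c y = chart_map c x"
        using True by (auto simp: tangent_line_def Let_def c_def)
      then show "y \<in> {x}" using c chart_inv_map[of c] by (metis charts_at_iff singletonI)
    qed
    then have "(dyn_ball A g f x \<delta> n - {x}) \<inter> tangent_line k \<phi> x v = {}" for \<delta> n by blast
    then have "Q n \<delta> = 0" for n \<delta> by (simp add: Q_def bot_ennreal)
    moreover have "T n = 0" for n
      using deriv[of n] True linear_0[OF has_derivative_linear] by auto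
    moreover have "Lim (at_right (0::real)) (\<lambda>_. z) = z" for z :: ereal
      by (rule tendsto_Lim) simp_all
    ultimately show ?thesis unfolding new usual by simp
  next
    case False
    \<comment> \<open>The contribution of the denominator \<open>norm (v c)\<close> to the n-th
      term.\<close>
    define \<kappa> where "\<kappa> = (\<lambda>n. ereal (1 / real n * - ln (norm (v c))))"
    have "Lim (at_right 0) (\<lambda>\<delta>. ereal (1 / real n) * eln (Q n \<delta>)) = \<kappa> n + ereal (1 / real n) * eln (ennreal (T n))" for n
    proof -
      have "continuous_on UNIV f" using f unfolding differentiable_map_def by blast
      then have "(Q n \<longlongrightarrow> ennreal (T n / norm (v c))) (at_right 0)"
        using deriv[of n] SUP_diff_quot_tendsto[of f k \<phi> x v n] c False
        unfolding Q_def c_def[symmetric] by auto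
      then have "((\<lambda>\<delta>. ereal (1 / real n) * eln (Q n \<delta>)) \<longlongrightarrow>
          ereal (1 / real n) * eln (ennreal (T n / norm (v c)))) (at_right 0)"
        by (intro tendsto_cmult_ereal tendsto_eln) simp_all
      then have "Lim (at_right 0) (\<lambda>\<delta>. ereal (1 / real n) * eln (Q n \<delta>)) =
          ereal (1 / real n) * eln (ennreal (T n / norm (v c)))"
        by (intro tendsto_Lim) simp_all
      also have "eln (ennreal (T n / norm (v c))) = eln (ennreal (T n)) + ereal (- ln (norm (v c)))"
        using False by (intro eln_divide) (simp_all add: T_def tnorm_def)
      \<comment> \<open>Distributivity is safe because one summand is finite. At
        \<open>n = 0\<close> the factor is \<open>1 / 0 = 0\<close>, and 0 times \<infinity> is 0 in
        \<open>ereal\<close>.\<close>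
      also have "ereal (1 / real n) * \<dots> = \<kappa> n + ereal (1 / real n) * eln (ennreal (T n))"
        unfolding \<kappa>_def by (cases "eln (ennreal (T n))"; cases "n = 0") (simp_all add: algebra_simps)
      finally show ?thesis .
    qed
    moreover have "\<kappa> \<longlonglongrightarrow> 0"
      unfolding \<kappa>_def zero_ereal_def lim_ereal by (rule tendsto_mult_left_zero[OF lim_1_over_n])
    \<comment> \<open>A sequence with finite limit may be split off from a limes superior even if
      the latter is infinite.\<close>
    then have "limsup (\<lambda>n. \<kappa> n + ereal (1 / real n) * eln (ennreal (T n))) =
        0 + limsup (\<lambda>n. ereal (1 / real n) * eln (ennreal (T n)))"
      by (rule ereal_limsup_lim_add) simp
    ultimately show ?thesis unfolding new usual by simp
  qed
qed

end

theorem theorem1: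
  fixes A :: "'a::t2_space chart set"
    and g \<omega> :: "'a form2"
    and lam :: "'a measure"
    and k :: nat and \<phi> :: "nat \<Rightarrow> 'a chart"
    and f :: "'a \<Rightarrow> 'a"
  assumes "compact (UNIV :: 'a set)"
    and "connected (UNIV :: 'a set)"
    and "smooth_structure A"
    and "riemannian_metric A g"
    and "area_form A \<omega>"
    and "area_measure A \<omega> lam"
    and "\<And>i. i \<in> {1..k} \<Longrightarrow> \<phi> i \<in> A"
    and "(\<Union>i\<in>{1..k}. chart_dom (\<phi> i)) = UNIV"
    and "\<And>i. i \<in> {1..k} \<Longrightarrow> conservative_chart lam (\<phi> i)"
    and "differentiable_map A f"
  shows "\<forall>x. \<forall>v\<in>tangent_space A x. new_lyapunov A g k \<phi> f x v = usual_lyapunov A k \<phi> f x v"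
proof -
  interpret riemannian_surface A g
    using assms(3,4) by unfold_locales
  show ?thesis using new_lyapunov_eq_usual[OF assms(7,8,10)] by blast
qed

end
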